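(* Let $A$ and $Q$ be linear operators on $\mathcal{H}$, where $A$ has normalized eigenfunctions $\{e_k\}_{k\ge1}$ with $Ae_k=-\lambda_ke_k$ forming a basis of $\mathcal{H}$, and $Q$ is self-adjoint with eigenvalues $\{q_k\}_{k\ge1}$ and corresponding eigenfunctions $\{b_k\}_{k\ge1}$ forming an orthonormal basis of $\mathcal{H}$, such that: (1') there is $D>0$ with $b_j=e_j'$ for all $j>D$; (2') $q_j>0$ for all $j\ge1$; (3') $\sum_{j=1}^\infty q_j(\lambda_j')^{\gamma}<+\infty$ for some $\gamma>-1$; (4') $Q$ is bounded. Let $\alpha\in\mathbb{R}$ with $\alpha<\lambda_1$ be fixed and assume that $A_\alpha=A+\alpha$ is self-adjoint and generates a $\mathcal{C}_0$-contraction semigroup on $\mathcal{H}$. Then the covariance operator $V_\infty$ associated with the linear equation $\mathrm{d}w=A_\alpha w\,\mathrm{d}t+\sigma\,\mathrm{d}W_t$ satisfies $$\langle V_\infty f_1,f_2\rangle=\sigma^2\sum_{j_1=1}^\infty\sum_{j_2=1}^\infty\frac{\langle f_1,e_{j_2}\rangle\langle f_2,e_{j_1}\rangle}{\lambda_{j_1}+\lambda_{j_2}-2\alpha}\Big(\sum_{n=1}^\infty q_n\langle e_{j_1},b_n\rangle\langle e_{j_2},b_n\rangle\Big)$$ for any $f_1,f_2\in\mathcal{H}$.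
   Context: $L>0$, $\mathcal{O}=[0,L]$, $\mathcal{H}=L^2(\mathcal{O})$ with scalar product $\langle\cdot,\cdot\rangle$, $\sigma>0$. $\lambda_j'=(\pi j/L)^2$ and $e_j'(x)=\sqrt{2/L}\,\sin(\pi jx/L)$ are (up to sign) the eigenvalues and the normalized eigenfunctions of the Dirichlet Laplacian on $\mathcal{O}$. The eigenvalues $-\lambda_k$ of $A$ are ordered so that $\lambda_1\le\lambda_2\le\cdots$, and the basis $\{e_k\}$ is orthonormal. $W_t$ is a $Q$-Wiener process (cylindrical/generalized if $Q$ is bounded but not trace class). The covariance operator is $$V(t)=\sigma^2\int_0^t e^{A_\alpha s}Qe^{A_\alpha^*s}\,\mathrm{d}s,\qquad V_\infty=\lim_{t\to\infty}V(t),$$ where ${}^*$ is the adjoint in $\mathcal{H}$; $V_\infty$ is the covariance operator of the (Gaussian, mean zero) invariant measure of the linear equation; it is linear, self-adjoint, non-negative and continuous on $\mathcal{H}$. The double series is an iterated sum in the order written. *)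

theory Defs
  imports "HOL-Analysis.Analysis"
begin

definition square_integrable_funs :: "real \<Rightarrow> (real \<Rightarrow> real) set" where
  "square_integrable_funs L =
     {f. f \<in> borel_measurable (lebesgue_on {0..L}) \<and> integrable (lebesgue_on {0..L}) (\<lambda>x. (f x)\<^sup>2)}"

text \<open>
  A type cannot depend on the real number \<open>L\<close>, so the space of classes of square-integrable
  functions on \<open>[0,L]\<close> is given as a type \<open>'h\<close> together with the class map \<open>cls\<close>: linear, onto, and
  carrying the \<open>L\<^sup>2\<close> scalar product. In particular \<open>cls f = cls g\<close> iff \<open>f = g\<close> almost everywhere
  on \<open>[0,L]\<close>, so \<open>cls\<close> identifies \<open>'h\<close> isometrically with the usual quotient.
  Every \<open>L > 0\<close> is covered, e.g. by the quotient over \<open>[0,1]\<close> with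
  \<open>cls f\<close> the class of \<open>x \<mapsto> sqrt L * f (L * x)\<close>.
\<close>

definition is_L2_interval :: "real \<Rightarrow> ((real \<Rightarrow> real) \<Rightarrow> 'h::real_inner) \<Rightarrow> bool" where
  "is_L2_interval L cls \<longleftrightarrow>
     (\<forall>f\<in>square_integrable_funs L. \<forall>g\<in>square_integrable_funs L.
        cls (\<lambda>x. f x + g x) = cls f + cls g) \<and>
     (\<forall>c. \<forall>f\<in>square_integrable_funs L. cls (\<lambda>x. c * f x) = c *\<^sub>R cls f) \<and>
     (\<forall>f\<in>square_integrable_funs L. \<forall>g\<in>square_integrable_funs L.
        cls f \<bullet> cls g = (LINT x|lebesgue_on {0..L}. f x * g x)) \<and>
     cls ` square_integrable_funs L = UNIV"

definition dirichlet_eigenvalue :: "real \<Rightarrow> nat \<Rightarrow> real" where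
  "dirichlet_eigenvalue L j = (pi * real j / L)\<^sup>2"

definition dirichlet_eigenfun :: "real \<Rightarrow> nat \<Rightarrow> real \<Rightarrow> real" where
  "dirichlet_eigenfun L j = (\<lambda>x. sqrt (2 / L) * sin (pi * real j * x / L))"

text \<open>Sequences are indexed from \<open>1\<close>; the value at \<open>0\<close> is irrelevant everywhere below.\<close>

definition orthonormal_basis :: "(nat \<Rightarrow> 'h::real_inner) \<Rightarrow> bool" where
  "orthonormal_basis e \<longleftrightarrow>
     (\<forall>j\<ge>1. \<forall>k\<ge>1. e j \<bullet> e k = (if j = k then 1 else 0)) \<and> closure (span (e ` {1..})) = UNIV"

text \<open>
  A possibly unbounded operator is a domain \<open>D\<close> together with a function \<open>A\<close>, whose values
  outside \<open>D\<close> are irrelevant.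
\<close>

definition linear_operator :: "'h::real_inner set \<Rightarrow> ('h \<Rightarrow> 'h) \<Rightarrow> bool" where
  "linear_operator D A \<longleftrightarrow>
     subspace D \<and> (\<forall>x\<in>D. \<forall>y\<in>D. A (x + y) = A x + A y) \<and> (\<forall>c. \<forall>x\<in>D. A (c *\<^sub>R x) = c *\<^sub>R A x)"

definition operator_graph :: "'h set \<Rightarrow> ('h \<Rightarrow> 'h) \<Rightarrow> ('h \<times> 'h) set" where
  "operator_graph D A = {(x, A x) |x. x \<in> D}"

definition adjoint_graph :: "'h::real_inner set \<Rightarrow> ('h \<Rightarrow> 'h) \<Rightarrow> ('h \<times> 'h) set" where
  "adjoint_graph D A = {(y, z). \<forall>x\<in>D. A x \<bullet> y = x \<bullet> z}"

definition self_adjoint_operator :: "'h::real_inner set \<Rightarrow> ('h \<Rightarrow> 'h) \<Rightarrow> bool" where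
  "self_adjoint_operator D A \<longleftrightarrow>
     linear_operator D A \<and> closure D = UNIV \<and> adjoint_graph D A = operator_graph D A"

definition C0_contraction_semigroup :: "(real \<Rightarrow> 'h::real_normed_vector \<Rightarrow> 'h) \<Rightarrow> bool" where
  "C0_contraction_semigroup S \<longleftrightarrow>
     (\<forall>t\<ge>0. bounded_linear (S t) \<and> onorm (S t) \<le> 1) \<and>
     (\<forall>x. S 0 x = x) \<and>
     (\<forall>s\<ge>0. \<forall>t\<ge>0. \<forall>x. S (s + t) x = S s (S t x)) \<and>
     (\<forall>x. ((\<lambda>t. S t x) \<longlongrightarrow> x) (at_right 0))"

definition generator_graph :: "(real \<Rightarrow> 'h::real_normed_vector \<Rightarrow> 'h) \<Rightarrow> ('h \<times> 'h) set" where
  "generator_graph S = {(x, y). ((\<lambda>h. (S h x - x) /\<^sub>R h) \<longlongrightarrow> y) (at_right 0)}"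

text \<open>
  The operator-valued integral and limit defining the covariance operators are taken in the strong
  sense. \<open>S s\<close> stands for the semigroup operator at time \<open>s\<close>.
\<close>

definition covariance_integrand ::
  "(real \<Rightarrow> 'h::real_inner \<Rightarrow> 'h) \<Rightarrow> ('h \<Rightarrow> 'h) \<Rightarrow> 'h \<Rightarrow> real \<Rightarrow> 'h" where
  "covariance_integrand S Q f = (\<lambda>s. S s (Q (adjoint (S s) f)))"

definition covariance ::
  "real \<Rightarrow> (real \<Rightarrow> 'h::real_inner \<Rightarrow> 'h) \<Rightarrow> ('h \<Rightarrow> 'h) \<Rightarrow> real \<Rightarrow> 'h \<Rightarrow> 'h" where
  "covariance \<sigma> S Q t f = \<sigma>\<^sup>2 *\<^sub>R integral {0..t} (covariance_integrand S Q f)"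

definition covariance_inf ::
  "real \<Rightarrow> (real \<Rightarrow> 'h::real_inner \<Rightarrow> 'h) \<Rightarrow> ('h \<Rightarrow> 'h) \<Rightarrow> 'h \<Rightarrow> 'h" where
  "covariance_inf \<sigma> S Q f = Lim at_top (\<lambda>t. covariance \<sigma> S Q t f)"

end

theory Submission
  imports Defs "HOL-Real_Asymp.Real_Asymp"
begin

text \<open>
  The operators \<open>S t\<close> are diagonal in the basis \<open>e\<close>: a generator eigenvector with eigenvalue
  \<open>-\<mu>\<^sub>k = \<alpha> - lam k\<close> is an eigenvector of \<open>S t\<close> with eigenvalue \<open>exp (- \<mu>\<^sub>k t)\<close>
  (\<open>contraction_semigroup_eigenvector\<close>). A bounded operator that is diagonal in an orthonormal basis
  is symmetric and its norm is at most the supremum of the moduli of its eigenvalues, so \<open>S t\<close> is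
  its own adjoint and \<open>norm (S t x) \<le> exp (- \<mu>\<^sub>1 t) * norm x\<close>. Hence the integrand \<open>S t (Q (S t f))\<close> is continuous
  in \<open>t\<close> and decays exponentially, and its integral over \<open>{0..t}\<close> converges to some \<open>V f\<close> as
  \<open>t\<close> grows.

  The function \<open>V\<close> inherits symmetry from the integrand, and
  \<open>V (e i) \<bullet> e j = (Q (e i) \<bullet> e j) / (\<mu>\<^sub>i + \<mu>\<^sub>j)\<close>, because
  \<open>S t (Q (S t (e i))) \<bullet> e j = exp (- (\<mu>\<^sub>i + \<mu>\<^sub>j) t) * (Q (e i) \<bullet> e j)\<close>. The number
  \<open>Q (e i) \<bullet> e j\<close> is the series over \<open>n\<close> by Parseval in the eigenbasis \<open>b\<close> of \<open>Q\<close>. The double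
  series then needs no interchange of limits, only Parseval in the basis \<open>e\<close> twice:
  the inner series expands \<open>f1 \<bullet> V (e j) = V f1 \<bullet> e j\<close> and the outer one expands \<open>V f1 \<bullet> f2\<close>.
\<close>

section \<open>Orthonormal bases and diagonal operators\<close>

text \<open>
  The partial sums are contractions, and on the span of the basis they are eventually the identity;
  both facts together give convergence on the closure of the span.
\<close>

lemma orthonormal_basis_sums:
  fixes e :: "nat \<Rightarrow> 'h::real_inner"
  assumes "orthonormal_basis e"
  shows "(\<lambda>n. (x \<bullet> e (Suc n)) *\<^sub>R e (Suc n)) sums x"
proof -
  have on: "e (Suc j) \<bullet> e (Suc k) = (if j = k then 1 else 0)" for j k
    using assms by (simp add: orthonormal_basis_def)
  have dense: "x \<in> closure (span (e ` {1..}))" for x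
    using assms by (simp add: orthonormal_basis_def)
  define P where "P N x = (\<Sum>n<N. (x \<bullet> e (Suc n)) *\<^sub>R e (Suc n))" for N x
  have P_add: "P N (x + y) = P N x + P N y" for N x y
    by (simp add: P_def inner_add_left scaleR_left_distrib sum.distrib)
  have P_scaleR: "P N (c *\<^sub>R x) = c *\<^sub>R P N x" for N c x
    by (simp add: P_def scaleR_right.sum)
  have P_diff: "P N (x - y) = P N x - P N y" for N x y
    by (simp add: P_def inner_diff_left scaleR_left_diff_distrib sum_subtractf)
  have P_inner: "P N x \<bullet> e (Suc k) = x \<bullet> e (Suc k)" if "k < N" for N x k
    using that by (simp add: P_def inner_sum_left on if_distrib[of "\<lambda>t. _ * t"] cong: if_cong)
  have P_contraction: "norm (P N x) \<le> norm x" for N x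
  proof -
    have "P N x \<bullet> P N x = (\<Sum>n<N. (x \<bullet> e (Suc n)) * (P N x \<bullet> e (Suc n)))"
      by (subst (2) P_def) (simp add: inner_sum_right)
    also have "\<dots> = (\<Sum>n<N. (x \<bullet> e (Suc n)) * (x \<bullet> e (Suc n)))"
      by (intro sum.cong) (simp_all add: P_inner)
    also have "\<dots> = x \<bullet> P N x"
      by (simp add: P_def inner_sum_right)
    finally have "norm (P N x) * norm (P N x) = x \<bullet> P N x"
      by (simp add: power2_norm_eq_inner[symmetric] power2_eq_square)
    also have "\<dots> \<le> norm x * norm (P N x)"
      by (rule norm_cauchy_schwarz)
    finally show ?thesis
      by (cases "P N x = 0") auto
  qed
  have P_span: "\<forall>\<^sub>F N in sequentially. P N y = y" if "y \<in> span (e ` {1..})" for y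
    using that
  proof (induction rule: span_induct_alt)
    case base
    then show ?case by (simp add: P_def)
  next
    case (step c v y)
    then obtain k where k: "v = e (Suc k)"
      by (metis atLeast_iff imageE not0_implies_Suc not_one_le_zero)
    have "P N v = v" if "k < N" for N
      using that by (simp add: P_def k on if_distrib[of "\<lambda>t. t *\<^sub>R _"] cong: if_cong)
    then have "\<forall>\<^sub>F N in sequentially. P N v = v"
      by (metis (mono_tags, lifting) eventually_gt_at_top eventually_mono)
    with step.IH show ?case
      by eventually_elim (simp add: P_add P_scaleR)
  qed
  have "(\<lambda>N. P N x) \<longlonglongrightarrow> x"
  proof (rule tendstoI)
    fix \<epsilon> :: real assume "0 < \<epsilon>"
    then obtain y where y: "y \<in> span (e ` {1..})" "dist y x < \<epsilon> / 2"
      using dense[of x] unfolding closure_approachable by (meson half_gt_zero)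
    show "\<forall>\<^sub>F N in sequentially. dist (P N x) x < \<epsilon>"
      using P_span[OF y(1)]
    proof eventually_elim
      case (elim N)
      have "dist (P N x) x \<le> dist (P N x) (P N y) + dist y x"
        using dist_triangle[of "P N x" x y] elim by simp
      also have "dist (P N x) (P N y) \<le> dist y x"
        using P_contraction[of N "x - y"] by (simp add: dist_norm P_diff norm_minus_commute)
      finally show ?case using y(2) by simp
    qed
  qed
  then show ?thesis
    by (simp add: sums_def P_def)
qed

lemma parseval_sums:
  fixes e :: "nat \<Rightarrow> 'h::real_inner"
  assumes "orthonormal_basis e"
  shows "(\<lambda>n. (x \<bullet> e (Suc n)) * (y \<bullet> e (Suc n))) sums (x \<bullet> y)"
  using bounded_linear.sums[OF bounded_linear_inner_right[of y] orthonormal_basis_sums[OF assms, of x]]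
  by (simp add: inner_commute)

text \<open>
  Expanding \<open>x\<close> gives \<open>T x \<bullet> y\<close> as the sum of the \<open>m n * ((x \<bullet> e (Suc n)) * (y \<bullet> e (Suc n)))\<close>,
  which does not change when \<open>x\<close> and \<open>y\<close> are exchanged.
\<close>

lemma diagonal_operator_symmetric:
  fixes T :: "'h::real_inner \<Rightarrow> 'h"
  assumes "orthonormal_basis e" and T: "bounded_linear T"
    and diag: "\<And>k. T (e (Suc k)) = m k *\<^sub>R e (Suc k)"
  shows "T x \<bullet> y = x \<bullet> T y"
proof -
  have expand: "(\<lambda>n. m n * ((x \<bullet> e (Suc n)) * (y \<bullet> e (Suc n)))) sums (T x \<bullet> y)" for x y
  proof -
    have "(\<lambda>n. T ((x \<bullet> e (Suc n)) *\<^sub>R e (Suc n)) \<bullet> y) sums (T x \<bullet> y)"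
      by (intro bounded_linear.sums[OF bounded_linear_inner_left] bounded_linear.sums[OF T]
          orthonormal_basis_sums assms)
    then show ?thesis
      by (simp add: linear_scale[OF bounded_linear.linear[OF T]] diag inner_commute mult_ac)
  qed
  show ?thesis
    using sums_unique2[OF expand[of x y]] expand[of y x] by (simp add: inner_commute mult_ac)
qed

text \<open>
  By symmetry \<open>T\<close> multiplies the coefficient at \<open>e (Suc k)\<close> by \<open>m k\<close>, so the bound is a termwise
  comparison of the Parseval series of \<open>T x\<close> and \<open>x\<close>.
\<close>

lemma diagonal_operator_norm_le:
  fixes T :: "'h::real_inner \<Rightarrow> 'h"
  assumes e: "orthonormal_basis e" and T: "bounded_linear T"
    and diag: "\<And>k. T (e (Suc k)) = m k *\<^sub>R e (Suc k)"
    and bound: "\<And>k. \<bar>m k\<bar> \<le> M"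
  shows "norm (T x) \<le> M * norm x"
proof (rule power2_le_imp_le)
  have coeff: "T x \<bullet> e (Suc k) = m k * (x \<bullet> e (Suc k))" for k
    using diagonal_operator_symmetric[OF e T diag, of x "e (Suc k)"] by (simp add: diag)
  have "M \<ge> 0"
    using bound[of 0] by linarith
  then show "0 \<le> M * norm x"
    by simp
  have "T x \<bullet> T x \<le> M\<^sup>2 * (x \<bullet> x)"
  proof (rule sums_le[OF _ parseval_sums[OF e] sums_mult[OF parseval_sums[OF e]]])
    fix k
    have "(m k)\<^sup>2 \<le> M\<^sup>2"
      using bound[of k] \<open>M \<ge> 0\<close> by (simp add: abs_le_square_iff[symmetric])
    then have "(m k)\<^sup>2 * (x \<bullet> e (Suc k))\<^sup>2 \<le> M\<^sup>2 * (x \<bullet> e (Suc k))\<^sup>2"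
      by (rule mult_right_mono) simp
    then show "(T x \<bullet> e (Suc k)) * (T x \<bullet> e (Suc k)) \<le> M\<^sup>2 * ((x \<bullet> e (Suc k)) * (x \<bullet> e (Suc k)))"
      by (simp add: coeff power2_eq_square mult_ac)
  qed
  then show "(norm (T x))\<^sup>2 \<le> (M * norm x)\<^sup>2"
    by (simp add: power2_norm_eq_inner power_mult_distrib)
qed

section \<open>Contraction semigroups\<close>

lemma contraction_semigroup_norm_le:
  assumes "C0_contraction_semigroup S" "t \<ge> 0"
  shows "norm (S t x) \<le> norm x"
proof -
  have "bounded_linear (S t)" "onorm (S t) \<le> 1"
    using assms by (auto simp: C0_contraction_semigroup_def)
  then show ?thesis
    using onorm[of "S t" x] mult_right_mono[of "onorm (S t)" 1 "norm x"] by simp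
qed

text \<open>
  Contractivity transports the continuity at \<open>0\<close> from the right, which is part of the definition,
  to both sides of every other time.
\<close>

lemma contraction_semigroup_dist:
  assumes S: "C0_contraction_semigroup S" and "s \<ge> 0" "t \<ge> 0"
  shows "norm (S s x - S t x) \<le> norm (S \<bar>s - t\<bar> x - x)"
  using \<open>s \<ge> 0\<close> \<open>t \<ge> 0\<close>
proof (induction s t rule: linorder_wlog)
  case (le s t)
  have "S (s + u) x = S s (S u x)" if "u \<ge> 0" for u
    using S le that by (simp add: C0_contraction_semigroup_def)
  from this[of "t - s"] have "S t x = S s (S (t - s) x)"
    using le by simp
  moreover have "linear (S s)"
    using S le by (simp add: C0_contraction_semigroup_def bounded_linear.linear)
  ultimately have "S t x - S s x = S s (S (t - s) x - x)"
    by (simp add: linear_diff)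
  then show ?case
    using contraction_semigroup_norm_le[OF S, of s "S (t - s) x - x"] le
    by (simp add: norm_minus_commute[of "S s x"])
next
  case (sym s t)
  then show ?case by (simp add: norm_minus_commute abs_minus_commute)
qed

text \<open>
  Joint strong continuity: since the operators are contractions, the argument may vary with time.
\<close>

lemma contraction_semigroup_continuous:
  assumes S: "C0_contraction_semigroup S" and y: "continuous_on {0..} y"
  shows "continuous_on {0..} (\<lambda>t. S t (y t))"
  unfolding continuous_on_def
proof
  fix t :: real assume t: "t \<in> {0..}"
  let ?F = "at t within {0..}"
  have "((\<lambda>h. S h (y t) - y t) \<longlongrightarrow> 0) (at_right 0)"
    using S unfolding C0_contraction_semigroup_def by (metis LIM_zero)
  then have "((\<lambda>s. norm (S \<bar>s - t\<bar> (y t) - y t)) \<longlongrightarrow> 0) ?F"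
  proof (intro tendsto_norm_zero, elim filterlim_compose)
    have "((\<lambda>s. \<bar>s - t\<bar>) \<longlongrightarrow> \<bar>t - t\<bar>) ?F"
      by (intro tendsto_intros)
    then show "filterlim (\<lambda>s. \<bar>s - t\<bar>) (at_right 0) ?F"
      by (auto simp: filterlim_at eventually_at_filter)
  qed
  moreover have "((\<lambda>s. norm (y s - y t)) \<longlongrightarrow> 0) ?F"
    using y t by (auto simp: continuous_on_def intro!: tendsto_norm_zero LIM_zero)
  ultimately have lim: "((\<lambda>s. norm (y s - y t) + norm (S \<bar>s - t\<bar> (y t) - y t)) \<longlongrightarrow> 0) ?F"
    by (auto intro: tendsto_add_zero)
  have "norm (S s (y s) - S t (y t)) \<le> norm (y s - y t) + norm (S \<bar>s - t\<bar> (y t) - y t)"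
    if s: "s \<in> {0..}" for s
  proof -
    have "linear (S s)"
      using S s by (simp add: C0_contraction_semigroup_def bounded_linear.linear)
    then have "S s (y s) - S t (y t) = S s (y s - y t) + (S s (y t) - S t (y t))"
      by (simp add: linear_diff)
    also have "norm \<dots> \<le> norm (S s (y s - y t)) + norm (S s (y t) - S t (y t))"
      by (rule norm_triangle_ineq)
    also have "\<dots> \<le> norm (y s - y t) + norm (S \<bar>s - t\<bar> (y t) - y t)"
      using s t by (intro add_mono contraction_semigroup_norm_le[OF S]
          contraction_semigroup_dist[OF S]) auto
    finally show ?thesis .
  qed
  then have "\<forall>\<^sub>F s in ?F. norm (S s (y s) - S t (y t))
      \<le> norm (y s - y t) + norm (S \<bar>s - t\<bar> (y t) - y t)"
    by (auto simp: eventually_at_filter)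
  from Lim_null_comparison[OF this lim]
  show "((\<lambda>s. S s (y s)) \<longlongrightarrow> S t (y t)) ?F"
    by (rule LIM_zero_cancel)
qed

text \<open>
  With \<open>h = t / n\<close>, one step of length \<open>h\<close> costs an error \<open>r h = norm (S h x - exp (- \<mu> * h) *\<^sub>R x)\<close>,
  and contractivity keeps earlier errors from growing. So the error at time \<open>t\<close> is at most
  \<open>n * r (t / n)\<close>, which vanishes as \<open>n\<close> grows because \<open>r h / h\<close> tends to \<open>0\<close>. This avoids
  differentiating the orbit at positive times.
\<close>

lemma contraction_semigroup_eigenvector:
  assumes S: "C0_contraction_semigroup S" and gen: "(x, - \<mu> *\<^sub>R x) \<in> generator_graph S"
    and "\<mu> \<ge> 0" "t \<ge> 0"
  shows "S t x = exp (- \<mu> * t) *\<^sub>R x"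
proof (cases "t = 0")
  case True
  then show ?thesis using S by (simp add: C0_contraction_semigroup_def)
next
  case False
  with \<open>t \<ge> 0\<close> have "t > 0" by simp
  define r where "r h = norm (S h x - exp (- \<mu> * h) *\<^sub>R x)" for h
  have step: "norm (S (real n * h) x - exp (- \<mu> * (real n * h)) *\<^sub>R x) \<le> real n * r h"
    if "h \<ge> 0" for n h
  proof (induction n)
    case 0
    then show ?case using S by (simp add: C0_contraction_semigroup_def)
  next
    case (Suc n)
    let ?a = "exp (- \<mu> * (real n * h))"
    have "linear (S h)"
      using S that by (simp add: C0_contraction_semigroup_def bounded_linear.linear)
    moreover have "S (real (Suc n) * h) x = S h (S (real n * h) x)"
      using S that by (simp add: C0_contraction_semigroup_def algebra_simps)
    moreover have "exp (- \<mu> * (real (Suc n) * h)) = ?a * exp (- \<mu> * h)"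
      by (simp add: exp_add[symmetric] algebra_simps)
    ultimately have "S (real (Suc n) * h) x - exp (- \<mu> * (real (Suc n) * h)) *\<^sub>R x
        = S h (S (real n * h) x - ?a *\<^sub>R x) + ?a *\<^sub>R (S h x - exp (- \<mu> * h) *\<^sub>R x)"
      by (simp add: linear_diff linear_scale algebra_simps)
    also have "norm \<dots> \<le> norm (S h (S (real n * h) x - ?a *\<^sub>R x)) + ?a * r h"
      by (rule norm_triangle_le) (simp add: r_def)
    also have "norm (S h (S (real n * h) x - ?a *\<^sub>R x)) \<le> real n * r h"
      using contraction_semigroup_norm_le[OF S that] Suc.IH by (rule order_trans)
    also have "?a * r h \<le> r h"
      using that \<open>\<mu> \<ge> 0\<close> by (intro mult_left_le_one_le) (auto simp: r_def)
    finally show ?case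
      by (simp add: algebra_simps)
  qed
  have "((\<lambda>h. (S h x - x) /\<^sub>R h - ((exp (- \<mu> * h) - 1) / h) *\<^sub>R x) \<longlongrightarrow> - \<mu> *\<^sub>R x - (- \<mu>) *\<^sub>R x)
      (at_right 0)"
  proof (rule tendsto_diff[OF _ tendsto_scaleR[OF _ tendsto_const]])
    show "((\<lambda>h. (S h x - x) /\<^sub>R h) \<longlongrightarrow> - \<mu> *\<^sub>R x) (at_right 0)"
      using gen by (simp add: generator_graph_def)
    have "((\<lambda>h. exp (- \<mu> * h)) has_real_derivative - \<mu>) (at 0)"
      by (auto intro!: derivative_eq_intros)
    then have "((\<lambda>h. (exp (- \<mu> * h) - 1) / h) \<longlongrightarrow> - \<mu>) (at 0)"
      by (simp add: has_field_derivative_iff)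
    then show "((\<lambda>h. (exp (- \<mu> * h) - 1) / h) \<longlongrightarrow> - \<mu>) (at_right 0)"
      by (rule filterlim_mono[OF _ order_refl at_le]) simp
  qed
  then have "((\<lambda>h. norm ((S h x - x) /\<^sub>R h - ((exp (- \<mu> * h) - 1) / h) *\<^sub>R x)) \<longlongrightarrow> 0) (at_right 0)"
    by (simp add: tendsto_norm_zero)
  then have r_small: "((\<lambda>h. r h / h) \<longlongrightarrow> 0) (at_right 0)"
  proof (rule Lim_transform_eventually)
    show "\<forall>\<^sub>F h in at_right 0.
        norm ((S h x - x) /\<^sub>R h - ((exp (- \<mu> * h) - 1) / h) *\<^sub>R x) = r h / h"
      using eventually_at_right_less[of 0]
    proof eventually_elim
      case (elim h)
      have "(S h x - x) /\<^sub>R h - ((exp (- \<mu> * h) - 1) / h) *\<^sub>R x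
          = (S h x - exp (- \<mu> * h) *\<^sub>R x) /\<^sub>R h"
        by (simp add: algebra_simps divide_inverse)
      then show ?case using elim by (simp add: r_def divide_inverse mult.commute)
    qed
  qed
  have "filterlim (\<lambda>n. t / real (Suc n)) (at_right 0) sequentially"
    unfolding filterlim_at using \<open>t > 0\<close>
    by (auto intro!: LIMSEQ_Suc[OF lim_const_over_n] simp del: of_nat_Suc)
  from tendsto_mult_left[OF filterlim_compose[OF r_small this], of t]
  have "(\<lambda>n. real (Suc n) * r (t / real (Suc n))) \<longlonglongrightarrow> 0"
    using \<open>t > 0\<close> by (simp add: field_simps del: of_nat_Suc)
  moreover have "norm (S t x - exp (- \<mu> * t) *\<^sub>R x) \<le> real (Suc n) * r (t / real (Suc n))" for n
    using step[of "t / real (Suc n)" "Suc n"] \<open>t > 0\<close> by (simp del: of_nat_Suc)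
  ultimately have "norm (S t x - exp (- \<mu> * t) *\<^sub>R x) \<le> 0"
    by (intro LIMSEQ_le_const) auto
  then show ?thesis by simp
qed

section \<open>Exponentially decaying integrands\<close>

lemma exp_neg_has_integral:
  fixes c :: real
  assumes "c \<noteq> 0" "s \<le> t"
  shows "((\<lambda>u. exp (- c * u)) has_integral (exp (- c * s) - exp (- c * t)) / c) {s..t}"
proof -
  have "((\<lambda>u. exp (- c * u)) has_integral (- exp (- c * t) / c - - exp (- c * s) / c)) {s..t}"
    using assms by (intro fundamental_theorem_of_calculus)
      (auto intro!: derivative_eq_intros simp: has_real_derivative_iff_has_vector_derivative[symmetric])
  then show ?thesis by (simp add: diff_divide_distrib)
qed

text \<open>
  The Cauchy criterion along the integers yields the limit, and the tail estimate, which is uniform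
  in the upper end point, carries it over to real times.
\<close>

lemma exponentially_decaying_integral_convergent:
  fixes g :: "real \<Rightarrow> 'a::banach"
  assumes g: "continuous_on {0..} g" and "c > 0"
    and decay: "\<And>s. s \<ge> 0 \<Longrightarrow> norm (g s) \<le> C * exp (- c * s)"
  shows "\<exists>l. ((\<lambda>t. integral {0..t} g) \<longlongrightarrow> l) at_top"
proof -
  define G where "G t = integral {0..t} g" for t
  define T where "T s = C / c * exp (- c * s)" for s
  have "C \<ge> 0"
    using decay[of 0] norm_ge_zero[of "g 0"] by (simp del: norm_ge_zero)
  have tail: "norm (G t - G s) \<le> T s" if "0 \<le> s" "s \<le> t" for s t
  proof -
    have int: "g integrable_on {a..b}" if "0 \<le> a" for a b
      using that by (intro integrable_continuous_real continuous_on_subset[OF g]) auto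
    have "G t - G s = integral {s..t} g"
      using Henstock_Kurzweil_Integration.integral_combine[of 0 s t g] that int
      by (simp add: G_def algebra_simps)
    also have "norm \<dots> \<le> integral {s..t} (\<lambda>u. C * exp (- c * u))"
      using that \<open>c > 0\<close> decay
      by (intro integral_norm_bound_integral int integrable_on_mult_right
          has_integral_integrable[OF exp_neg_has_integral]) auto
    also have "\<dots> = C * ((exp (- c * s) - exp (- c * t)) / c)"
      using integral_unique[OF exp_neg_has_integral[of c s t]] that \<open>c > 0\<close> by simp
    also have "\<dots> \<le> T s"
      using \<open>c > 0\<close> \<open>C \<ge> 0\<close> by (simp add: T_def field_simps)
    finally show ?thesis .
  qed
  have "((\<lambda>s. exp (- c * s)) \<longlongrightarrow> 0) at_top"
    using \<open>c > 0\<close> by real_asymp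
  then have T_lim: "(T \<longlongrightarrow> 0) at_top"
    unfolding T_def by (intro tendsto_mult_right_zero)
  have "Cauchy (\<lambda>n. G (real n))"
  proof (rule metric_CauchyI)
    fix \<epsilon> :: real assume "0 < \<epsilon>"
    have "(\<lambda>n. T (real n)) \<longlonglongrightarrow> 0"
      by (rule filterlim_compose[OF T_lim filterlim_real_sequentially])
    then obtain N where N: "T (real N) < \<epsilon> / 2"
      using \<open>0 < \<epsilon>\<close> order_tendstoD(2)[of _ 0 sequentially "\<epsilon> / 2"]
      by (metis (mono_tags, lifting) eventually_sequentially half_gt_zero order_refl)
    have "dist (G (real m)) (G (real n)) < \<epsilon>" if "m \<ge> N" "n \<ge> N" for m n
    proof -
      have "dist (G (real m)) (G (real N)) < \<epsilon> / 2" "dist (G (real n)) (G (real N)) < \<epsilon> / 2"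
        using tail[of "real N" "real m"] tail[of "real N" "real n"] N that
        by (auto simp: dist_norm simp del: less_divide_eq_numeral1)
      then show ?thesis by (rule dist_triangle_half_l)
    qed
    then show "\<exists>M. \<forall>m\<ge>M. \<forall>n\<ge>M. dist (G (real m)) (G (real n)) < \<epsilon>" by blast
  qed
  then obtain l where l: "(\<lambda>n. G (real n)) \<longlonglongrightarrow> l"
    unfolding Cauchy_convergent_iff convergent_def by blast
  have "norm (G s - l) \<le> T s" if "s \<ge> 0" for s
  proof (rule LIMSEQ_le_const2)
    show "(\<lambda>n. norm (G s - G (real n))) \<longlonglongrightarrow> norm (G s - l)"
      by (intro tendsto_intros l)
    show "\<exists>N. \<forall>n\<ge>N. norm (G s - G (real n)) \<le> T s"
    proof (intro exI allI impI)
      fix n assume "n \<ge> nat \<lceil>s\<rceil>"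
      then have "s \<le> real n" by linarith
      then show "norm (G s - G (real n)) \<le> T s"
        using tail[OF that, of "real n"] by (simp add: norm_minus_commute)
    qed
  qed
  then have "\<forall>\<^sub>F s in at_top. norm (G s - l) \<le> T s"
    by (auto simp: eventually_at_top_linorder)
  then have "((\<lambda>s. G s - l) \<longlongrightarrow> 0) at_top"
    using T_lim by (rule Lim_null_comparison)
  then show ?thesis
    unfolding G_def by (blast intro: LIM_zero_cancel)
qed

section \<open>The stationary covariance\<close>

theorem theorem3p2:
  fixes L \<sigma> \<alpha> \<gamma> :: real
    and cls :: "(real \<Rightarrow> real) \<Rightarrow> 'h::{real_inner, banach}"
    and domA :: "'h set" and A Q :: "'h \<Rightarrow> 'h"
    and e b :: "nat \<Rightarrow> 'h" and lam q :: "nat \<Rightarrow> real"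
    and D :: nat
    and S :: "real \<Rightarrow> 'h \<Rightarrow> 'h"
  assumes "L > 0" and "\<sigma> > 0"
    and H_L2: "is_L2_interval L cls"
    and A_linear: "linear_operator domA A"
    and e_basis: "orthonormal_basis e"
    and e_eigen: "\<And>k. k \<ge> 1 \<Longrightarrow> e k \<in> domA \<and> A (e k) = - lam k *\<^sub>R e k"
    and lam_ordered: "mono_on {1..} lam"
    and Q_self_adjoint: "self_adjoint_operator UNIV Q"
    and b_basis: "orthonormal_basis b"
    and b_eigen: "\<And>k. k \<ge> 1 \<Longrightarrow> Q (b k) = q k *\<^sub>R b k"
    and cond1: "D > 0" "\<And>j. j > D \<Longrightarrow> b j = cls (dirichlet_eigenfun L j)"
    and cond2: "\<And>j. j \<ge> 1 \<Longrightarrow> q j > 0"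
    and cond3: "\<gamma> > -1" "summable (\<lambda>j. q (Suc j) * dirichlet_eigenvalue L (Suc j) powr \<gamma>)"
    and cond4: "bounded_linear Q"
    and alpha: "\<alpha> < lam 1"
    and A_alpha_self_adjoint: "self_adjoint_operator domA (\<lambda>x. A x + \<alpha> *\<^sub>R x)"
    and S_semigroup: "C0_contraction_semigroup S"
    and S_generated: "generator_graph S = operator_graph domA (\<lambda>x. A x + \<alpha> *\<^sub>R x)"
  shows "\<forall>f1 f2.
      (\<forall>t\<ge>0. covariance_integrand S Q f1 integrable_on {0..t}) \<and>
      ((\<lambda>t. covariance \<sigma> S Q t f1) \<longlongrightarrow> covariance_inf \<sigma> S Q f1) at_top \<and>
      (\<forall>j1\<ge>1. \<forall>j2\<ge>1. summable (\<lambda>n. q (Suc n) * (e j1 \<bullet> b (Suc n)) * (e j2 \<bullet> b (Suc n)))) \<and>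
      (\<forall>j1\<ge>1. summable (\<lambda>j2. (f1 \<bullet> e (Suc j2)) * (f2 \<bullet> e j1) / (lam j1 + lam (Suc j2) - 2 * \<alpha>) *
         (\<Sum>n. q (Suc n) * (e j1 \<bullet> b (Suc n)) * (e (Suc j2) \<bullet> b (Suc n))))) \<and>
      summable (\<lambda>j1. \<Sum>j2. (f1 \<bullet> e (Suc j2)) * (f2 \<bullet> e (Suc j1)) /
         (lam (Suc j1) + lam (Suc j2) - 2 * \<alpha>) *
         (\<Sum>n. q (Suc n) * (e (Suc j1) \<bullet> b (Suc n)) * (e (Suc j2) \<bullet> b (Suc n)))) \<and>
      covariance_inf \<sigma> S Q f1 \<bullet> f2 =
        \<sigma>\<^sup>2 * (\<Sum>j1. \<Sum>j2. (f1 \<bullet> e (Suc j2)) * (f2 \<bullet> e (Suc j1)) /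
         (lam (Suc j1) + lam (Suc j2) - 2 * \<alpha>) *
         (\<Sum>n. q (Suc n) * (e (Suc j1) \<bullet> b (Suc n)) * (e (Suc j2) \<bullet> b (Suc n))))"
proof -
  define \<mu> where "\<mu> k = lam k - \<alpha>" for k
  have mu_ge: "\<mu> 1 \<le> \<mu> (Suc k)" for k
    using mono_onD[OF lam_ordered, of 1 "Suc k"] by (simp add: \<mu>_def)
  have "\<mu> 1 > 0"
    using alpha by (simp add: \<mu>_def)
  have mu_pos: "\<mu> (Suc k) > 0" for k
    using mu_ge[of k] \<open>\<mu> 1 > 0\<close> by linarith

  have S_linear: "bounded_linear (S t)" if "t \<ge> 0" for t
    using S_semigroup that by (simp add: C0_contraction_semigroup_def)
  have S_eigen: "S t (e (Suc k)) = exp (- \<mu> (Suc k) * t) *\<^sub>R e (Suc k)" if "t \<ge> 0" for t k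
  proof (rule contraction_semigroup_eigenvector[OF S_semigroup])
    have "(e (Suc k), - \<mu> (Suc k) *\<^sub>R e (Suc k))
        \<in> operator_graph domA (\<lambda>x. A x + \<alpha> *\<^sub>R x)"
      using e_eigen[of "Suc k"] by (simp add: operator_graph_def \<mu>_def algebra_simps)
    then show "(e (Suc k), - \<mu> (Suc k) *\<^sub>R e (Suc k)) \<in> generator_graph S"
      by (simp add: S_generated)
  qed (use that mu_pos[of k] in simp_all)
  have S_sym: "S t x \<bullet> y = x \<bullet> S t y" if "t \<ge> 0" for t x y
    by (rule diagonal_operator_symmetric[OF e_basis S_linear[OF that] S_eigen[OF that]])
  then have S_adjoint: "adjoint (S t) = S t" if "t \<ge> 0" for t
    using that by (intro adjoint_unique) blast
  have S_decay: "norm (S t x) \<le> exp (- \<mu> 1 * t) * norm x" if "t \<ge> 0" for t x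
    using that mu_ge
    by (intro diagonal_operator_norm_le[OF e_basis S_linear[OF that] S_eigen[OF that]])
      (simp add: mult_right_mono)
  have Q_sym: "Q x \<bullet> y = x \<bullet> Q y" for x y
  proof -
    have "(y, Q y) \<in> adjoint_graph UNIV Q"
      using Q_self_adjoint by (auto simp: self_adjoint_operator_def operator_graph_def)
    then show ?thesis by (simp add: adjoint_graph_def)
  qed
  have Q_matrix: "(\<lambda>n. q (Suc n) * (x \<bullet> b (Suc n)) * (y \<bullet> b (Suc n))) sums (Q x \<bullet> y)" for x y
    using parseval_sums[OF b_basis, of "Q x" y] by (simp add: Q_sym b_eigen)

  define g where "g f s = S s (Q (S s f))" for f s
  have integrand: "covariance_integrand S Q f s = g f s" if "s \<ge> 0" for f s
    using that by (simp add: covariance_integrand_def g_def S_adjoint)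
  have g_cont: "continuous_on {0..} (g f)" for f
    unfolding g_def
    by (intro contraction_semigroup_continuous[OF S_semigroup] bounded_linear.continuous_on[OF cond4]
        continuous_on_const)
  have g_int: "g f integrable_on {0..t}" for f t
    by (intro integrable_continuous_real continuous_on_subset[OF g_cont]) auto
  have g_decay: "norm (g f s) \<le> (onorm Q * norm f) * exp (- (2 * \<mu> 1) * s)" if "s \<ge> 0" for f s
  proof -
    have "norm (g f s) \<le> exp (- \<mu> 1 * s) * norm (Q (S s f))"
      unfolding g_def by (rule S_decay[OF that])
    also have "\<dots> \<le> exp (- \<mu> 1 * s) * (onorm Q * (exp (- \<mu> 1 * s) * norm f))"
      by (intro mult_left_mono order_trans[OF onorm[OF cond4]] S_decay that
          onorm_pos_le[OF cond4]) simp
    also have "\<dots> = (onorm Q * norm f) * (exp (- \<mu> 1 * s) * exp (- \<mu> 1 * s))"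
      by simp
    also have "exp (- \<mu> 1 * s) * exp (- \<mu> 1 * s) = exp (- (2 * \<mu> 1) * s)"
      by (simp add: exp_add[symmetric])
    finally show ?thesis .
  qed
  have g_sym: "g x s \<bullet> y = x \<bullet> g y s" if "s \<ge> 0" for x y s
    using that by (simp add: g_def S_sym Q_sym)

  have "\<exists>l. ((\<lambda>t. integral {0..t} (g f)) \<longlongrightarrow> l) at_top" for f
    using g_cont _ g_decay
    by (rule exponentially_decaying_integral_convergent) (use \<open>\<mu> 1 > 0\<close> in simp)
  then obtain V where V: "((\<lambda>t. integral {0..t} (g f)) \<longlongrightarrow> V f) at_top" for f
    by metis
  have V_inner: "((\<lambda>t. integral {0..t} (\<lambda>s. g x s \<bullet> y)) \<longlongrightarrow> V x \<bullet> y) at_top" for x y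
  proof -
    have "integral {0..t} (\<lambda>s. g x s \<bullet> y) = integral {0..t} (g x) \<bullet> y" for t
      using integral_linear[OF g_int[of x t] bounded_linear_inner_left[of y]] by (simp add: o_def)
    then show ?thesis
      using V[of x] by (auto intro!: tendsto_intros)
  qed
  have V_sym: "V x \<bullet> y = x \<bullet> V y" for x y
  proof -
    have "integral {0..t} (\<lambda>s. g x s \<bullet> y) = integral {0..t} (\<lambda>s. g y s \<bullet> x)" for t
      by (rule integral_cong) (metis atLeastAtMost_iff g_sym inner_commute)
    then show ?thesis
      using tendsto_unique[OF _ V_inner[of x y]] V_inner[of y x] by (simp add: inner_commute)
  qed
  have V_matrix: "V (e (Suc i)) \<bullet> e (Suc j)
      = (Q (e (Suc i)) \<bullet> e (Suc j)) / (\<mu> (Suc i) + \<mu> (Suc j))" for i j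
  proof -
    define c where "c = \<mu> (Suc i) + \<mu> (Suc j)"
    have "c > 0"
      using mu_pos[of i] mu_pos[of j] by (simp add: c_def)
    have "g (e (Suc i)) s \<bullet> e (Suc j) = exp (- c * s) * (Q (e (Suc i)) \<bullet> e (Suc j))"
      if "s \<ge> 0" for s
      using that by (simp add: g_def S_sym S_eigen c_def exp_add[symmetric] algebra_simps
          linear_scale[OF bounded_linear.linear[OF cond4]])
    then have "integral {0..t} (\<lambda>s. g (e (Suc i)) s \<bullet> e (Suc j))
        = integral {0..t} (\<lambda>s. exp (- c * s) * (Q (e (Suc i)) \<bullet> e (Suc j)))" for t
      by (intro integral_cong) simp
    moreover have "integral {0..t} (\<lambda>s. exp (- c * s)) = (1 - exp (- c * t)) / c" if "t \<ge> 0" for t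
      using integral_unique[OF exp_neg_has_integral[of c 0 t]] \<open>c > 0\<close> that by simp
    ultimately have "\<forall>\<^sub>F t in at_top. integral {0..t} (\<lambda>s. g (e (Suc i)) s \<bullet> e (Suc j))
        = (1 - exp (- c * t)) / c * (Q (e (Suc i)) \<bullet> e (Suc j))"
      by (intro eventually_at_top_linorderI[of 0]) simp
    with V_inner have "((\<lambda>t. (1 - exp (- c * t)) / c * (Q (e (Suc i)) \<bullet> e (Suc j)))
        \<longlongrightarrow> V (e (Suc i)) \<bullet> e (Suc j)) at_top"
      by (rule Lim_transform_eventually)
    moreover have "((\<lambda>t. (1 - exp (- c * t)) / c) \<longlongrightarrow> inverse c) at_top"
      using \<open>c > 0\<close> by real_asymp
    then have "((\<lambda>t. (1 - exp (- c * t)) / c * (Q (e (Suc i)) \<bullet> e (Suc j)))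
        \<longlongrightarrow> inverse c * (Q (e (Suc i)) \<bullet> e (Suc j))) at_top"
      by (intro tendsto_intros)
    ultimately have "V (e (Suc i)) \<bullet> e (Suc j) = inverse c * (Q (e (Suc i)) \<bullet> e (Suc j))"
      by (rule tendsto_unique[OF trivial_limit_at_top_linorder])
    then show ?thesis by (simp add: c_def divide_inverse)
  qed

  have cov_eq: "covariance \<sigma> S Q t f = \<sigma>\<^sup>2 *\<^sub>R integral {0..t} (g f)" for t f
    unfolding covariance_def
    by (intro arg_cong[where f = "\<lambda>v. \<sigma>\<^sup>2 *\<^sub>R v"] integral_cong) (simp add: integrand)
  have cov_lim: "((\<lambda>t. covariance \<sigma> S Q t f) \<longlongrightarrow> \<sigma>\<^sup>2 *\<^sub>R V f) at_top" for f
    unfolding cov_eq by (intro tendsto_intros V)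
  then have cov_inf: "covariance_inf \<sigma> S Q f = \<sigma>\<^sup>2 *\<^sub>R V f" for f
    unfolding covariance_inf_def by (intro tendsto_Lim) simp_all
  have cov_int: "covariance_integrand S Q f integrable_on {0..t}" for f t
    using g_int[of f t] by (rule integrable_eq) (simp add: integrand)

  have inner_sum: "(\<lambda>j2. (f1 \<bullet> e (Suc j2)) * (f2 \<bullet> e (Suc j1)) /
       (lam (Suc j1) + lam (Suc j2) - 2 * \<alpha>) *
       (\<Sum>n. q (Suc n) * (e (Suc j1) \<bullet> b (Suc n)) * (e (Suc j2) \<bullet> b (Suc n))))
     sums ((V f1 \<bullet> e (Suc j1)) * (f2 \<bullet> e (Suc j1)))" for f1 f2 j1
  proof -
    \<comment> \<open>Parseval is applied to \<open>f1\<close> and \<open>V (e (Suc j1))\<close>, whose coefficients are the matrix entries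
      computed above; symmetry of \<open>V\<close> then turns the sum into \<open>V f1 \<bullet> e (Suc j1)\<close>.\<close>
    have "(\<lambda>j2. (f1 \<bullet> e (Suc j2)) * (V (e (Suc j1)) \<bullet> e (Suc j2)) * (f2 \<bullet> e (Suc j1)))
        sums ((f1 \<bullet> V (e (Suc j1))) * (f2 \<bullet> e (Suc j1)))"
      by (intro sums_mult2 parseval_sums e_basis)
    moreover have "(f1 \<bullet> e (Suc j2)) * (V (e (Suc j1)) \<bullet> e (Suc j2)) * (f2 \<bullet> e (Suc j1))
        = (f1 \<bullet> e (Suc j2)) * (f2 \<bullet> e (Suc j1)) / (lam (Suc j1) + lam (Suc j2) - 2 * \<alpha>) *
          (\<Sum>n. q (Suc n) * (e (Suc j1) \<bullet> b (Suc n)) * (e (Suc j2) \<bullet> b (Suc n)))" for j2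
    proof -
      have "lam (Suc j1) + lam (Suc j2) - 2 * \<alpha> = \<mu> (Suc j1) + \<mu> (Suc j2)"
        by (simp add: \<mu>_def)
      then show ?thesis
        by (simp add: V_matrix sums_unique[OF Q_matrix, symmetric])
    qed
    ultimately show ?thesis
      by (simp only: V_sym)
  qed
  have outer_sum: "(\<lambda>j1. \<Sum>j2. (f1 \<bullet> e (Suc j2)) * (f2 \<bullet> e (Suc j1)) /
       (lam (Suc j1) + lam (Suc j2) - 2 * \<alpha>) *
       (\<Sum>n. q (Suc n) * (e (Suc j1) \<bullet> b (Suc n)) * (e (Suc j2) \<bullet> b (Suc n))))
     sums (V f1 \<bullet> f2)" for f1 f2
    unfolding sums_unique[OF inner_sum, symmetric] by (rule parseval_sums[OF e_basis])
  have inner_summable: "summable (\<lambda>j2. (f1 \<bullet> e (Suc j2)) * (f2 \<bullet> e j1) /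
       (lam j1 + lam (Suc j2) - 2 * \<alpha>) *
       (\<Sum>n. q (Suc n) * (e j1 \<bullet> b (Suc n)) * (e (Suc j2) \<bullet> b (Suc n))))"
    if "j1 \<ge> 1" for f1 f2 j1
    using sums_summable[OF inner_sum[of f1 f2 "j1 - 1"]] that by simp
  show ?thesis
    unfolding cov_inf inner_scaleR_left sums_unique[OF outer_sum, symmetric]
    by (intro allI conjI impI refl cov_int cov_lim inner_summable sums_summable[OF Q_matrix]
        sums_summable[OF outer_sum])
qed

end
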